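(* Let $k\ge 1$ be an integer. For all integers $i,j\ge 0$ with $i+j\le k$, let $F_{i,j}(t;k)=\sum_{n\ge 0} f_{i,j}(n,k)\,t^n$ be the generating function (formal power series in $t$) for the number $f_{i,j}(n,k)$ of paths of length $n$ from $(0,0)$ to $(i,j)$ in the directed graph $D_k$. Arrange these generating functions into a vector $(x_1,\ldots,x_{\binom{k+2}{2}})$ by setting $$x_{i(2k-i+3)/2+j+1}=F_{i,j}(t;k)\qquad (i,j\ge 0,\ i+j\le k).$$ Let $F_k$ be the $\binom{k+2}{2}\times\binom{k+2}{2}$ block tridiagonal matrix defined in the context. Then $$F_k\cdot (x_1,\ldots,x_{\binom{k+2}{2}})^T=(1,0,\ldots,0)^T .$$
   Context: The directed graph $D_k$ has vertex set $V_k=\{(i,j): i,j\in\mathbb{Z}_{\ge 0},\ i+j\le k\}$. There is a directed edge from $(a,b)\in V_k$ to $(c,d)\in V_k$ exactly when $(c,d)$ is one of $(a,b+1)$, $(a-1,b)$, $(a+1,b-1)$. A path of length $n$ in $D_k$ is a sequence of vertices $v_0,v_1,\ldots,v_n$ such that $(v_{l},v_{l+1})$ is a directed edge for each $0\le l<n$; vertices may repeat. $f_{i,j}(n,k)$ is the number of paths of length $n$ in $D_k$ with $v_0=(0,0)$ and $v_n=(i,j)$. For integers $p,q,s$ with $p,q\ge 1$, $J_{p,q;s}$ is the $p\times q$ matrix whose $(a,b)$ entry is $1$ if $b-a=s$ and $0$ otherwise. Define $$A_p=J_{p,p;0}-t\,J_{p,p;-1}\ (p\ge 1),\qquad E_p=-t\,J_{p,p-1;0}\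 (p\ge 2),\qquad E'_p=-t\,J_{p,p+1;1}\ (p\ge 1).$$ The matrix $F_k$ is the block matrix with $k+1$ block rows and block columns, indexed by $i=0,1,\ldots,k$, whose $i$-th diagonal block is $A_{k+1-i}$ (of size $(k+1-i)\times(k+1-i)$), whose block in position $(i,i+1)$ is $E_{k+1-i}$ for $0\le i\le k-1$, whose block in position $(i,i-1)$ is $E'_{k+1-i}$ for $1\le i\le k$, and all of whose other blocks are zero: $$F_k=\begin{pmatrix} A_{k+1} & E_{k+1} & & & \\ E'_k & A_k & E_k & & \\ & \ddots & \ddots & \ddots & \\ & & E'_2 & A_2 & E_2\\ & & & E'_1 & A_1\end{pmatrix}.$$ *)

theory Defs
  imports
    "Jordan_Normal_Form.Matrix"
    "Graph_Theory.Vertex_Walk"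
    "HOL-Computational_Algebra.Formal_Power_Series"
begin

text \<open>The disjunct \<open>Suc c = a \<and> d = b\<close> is \<open>(c, d) = (a - 1, b)\<close>, and
  \<open>c = Suc a \<and> Suc d = b\<close> is \<open>(c, d) = (a + 1, b - 1)\<close>, avoiding truncated subtraction.\<close>

definition step :: "nat \<times> nat \<Rightarrow> nat \<times> nat \<Rightarrow> bool" where
  "step = (\<lambda>(a, b) (c, d).
     (c = a \<and> d = Suc b) \<or> (Suc c = a \<and> d = b) \<or> (c = Suc a \<and> Suc d = b))"

definition D_verts :: "nat \<Rightarrow> (nat \<times> nat) set" where
  "D_verts k = {(i, j). i + j \<le> k}"

definition D :: "nat \<Rightarrow> (nat \<times> nat, (nat \<times> nat) \<times> (nat \<times> nat)) pre_digraph" where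
  "D k = \<lparr> verts = D_verts k,
           arcs = {(u, v). u \<in> D_verts k \<and> v \<in> D_verts k \<and> step u v},
           tail = fst, head = snd \<rparr>"

text \<open>Vertices may repeat, so the relevant notion is that of a walk given by its list of
  vertices; \<open>vwalk_length p = length p - 1\<close> is the number of edges.\<close>

definition num_paths :: "nat \<Rightarrow> nat \<Rightarrow> nat \<Rightarrow> nat \<Rightarrow> nat" where
  "num_paths i j n k =
     card {p. vwalk p (D k) \<and> vwalk_length p = n \<and> hd p = (0, 0) \<and> last p = (i, j)}"

definition path_gf :: "nat \<Rightarrow> nat \<Rightarrow> nat \<Rightarrow> int fps" where
  "path_gf i j k = Abs_fps (\<lambda>n. int (num_paths i j n k))"

text \<open>Matrix and vector entries are counted from \<open>0\<close>; the condition \<open>b - a = s\<close> is invariant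
  under this shift. The formal variable \<open>t\<close> is \<open>fps_X\<close>.\<close>

definition J_mat :: "nat \<Rightarrow> nat \<Rightarrow> int \<Rightarrow> int fps mat" where
  "J_mat p q s = mat p q (\<lambda>(a, b). if int b - int a = s then 1 else 0)"

definition A_mat :: "nat \<Rightarrow> int fps mat" where
  "A_mat p = J_mat p p 0 - fps_X \<cdot>\<^sub>m J_mat p p (-1)"

definition E_mat :: "nat \<Rightarrow> int fps mat" where
  "E_mat p = (- fps_X) \<cdot>\<^sub>m J_mat p (p - 1) 0"

definition E'_mat :: "nat \<Rightarrow> int fps mat" where
  "E'_mat p = (- fps_X) \<cdot>\<^sub>m J_mat p (p + 1) 1"

text \<open>\<open>block_mat m d B\<close> is the block matrix with \<open>m\<close> block rows and columns whose block
  \<open>B i j\<close>, for \<open>i, j < m\<close>, has size \<open>d i \<times> d j\<close>. \<open>block_start d i\<close> is the first row (column)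
  of block row (column) \<open>i\<close>, and \<open>block_index d a\<close> is the block row (column) containing row
  (column) \<open>a\<close>.\<close>

definition block_start :: "(nat \<Rightarrow> nat) \<Rightarrow> nat \<Rightarrow> nat" where
  "block_start d i = (\<Sum>l<i. d l)"

definition block_index :: "(nat \<Rightarrow> nat) \<Rightarrow> nat \<Rightarrow> nat" where
  "block_index d a = (LEAST i. a < block_start d (Suc i))"

definition block_mat :: "nat \<Rightarrow> (nat \<Rightarrow> nat) \<Rightarrow> (nat \<Rightarrow> nat \<Rightarrow> 'a mat) \<Rightarrow> 'a mat" where
  "block_mat m d B = mat (block_start d m) (block_start d m) (\<lambda>(a, b).
     let i = block_index d a; j = block_index d b
     in B i j $$ (a - block_start d i, b - block_start d j))"

definition F_block :: "nat \<Rightarrow> nat \<Rightarrow> nat \<Rightarrow> int fps mat" where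
  "F_block k i j =
     (if j = i then A_mat (k + 1 - i)
      else if j = i + 1 then E_mat (k + 1 - i)
      else if i = j + 1 then E'_mat (k + 1 - i)
      else 0\<^sub>m (k + 1 - i) (k + 1 - j))"

definition F_mat :: "nat \<Rightarrow> int fps mat" where
  "F_mat k = block_mat (k + 1) (\<lambda>i. k + 1 - i) (F_block k)"

lemma block_start_mono: "i \<le> j \<Longrightarrow> block_start d i \<le> block_start d j"
  unfolding block_start_def by (intro sum_mono2) auto

lemma block_index_eq:
  assumes "a < d i"
  shows "block_index d (block_start d i + a) = i"
  unfolding block_index_def
proof (rule Least_equality)
  show "block_start d i + a < block_start d (Suc i)"
    using assms by (simp add: block_start_def)
next
  fix j
  assume "block_start d i + a < block_start d (Suc j)"
  then show "i \<le> j"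
    using block_start_mono[of "Suc j" i d] by (meson not_less_eq_eq leD le_add1 le_trans)
qed

lemma block_start_add_less:
  assumes "i < m" and "a < d i"
  shows "block_start d i + a < block_start d m"
proof -
  have "block_start d i + a < block_start d (Suc i)"
    using assms(2) by (simp add: block_start_def)
  also have "\<dots> \<le> block_start d m"
    using assms(1) by (intro block_start_mono) simp
  finally show ?thesis .
qed

lemma block_mat_index:
  assumes "i < m" and "j < m" and "a < d i" and "b < d j"
  shows "block_mat m d B $$ (block_start d i + a, block_start d j + b) = B i j $$ (a, b)"
  using assms by (simp add: block_mat_def block_start_add_less block_index_eq)

lemma block_start_F: "block_start (\<lambda>i. k + 1 - i) (k + 1) = (k + 2) choose 2"
proof -
  have "block_start (\<lambda>i. k + 1 - i) (k + 1) = (\<Sum>l<k + 1. Suc l)"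
    unfolding block_start_def by (subst sum.nat_diff_reindex[symmetric]) (simp add: Suc_diff_le)
  also have "\<dots> = (k + 2) choose 2"
    by (induction k) (simp_all add: numeral_2_eq_2)
  finally show ?thesis .
qed

lemma F_mat_carrier: "F_mat k \<in> carrier_mat ((k + 2) choose 2) ((k + 2) choose 2)"
  by (simp add: F_mat_def block_mat_def block_start_F[simplified])

end

theory Submission
  imports Defs
begin

text \<open>The matrix \<open>F\<^sub>k\<close> is \<open>1 - t M\<^sup>T\<close> in disguise, where \<open>M\<close> is the adjacency matrix of
  \<open>D\<^sub>k\<close> and the vertices are listed as \<open>(0,0), (0,1), \<dots>, (0,k), (1,0), \<dots>, (k,0)\<close>. Block row
  \<open>i\<close> collects the vertices with first coordinate \<open>i\<close>: the off-diagonal part of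
  \<open>A\<^bsub>k+1-i\<^esub>\<close> records the edges \<open>(i, j - 1) \<rightarrow> (i, j)\<close>, the block \<open>E\<^bsub>k+1-i\<^esub>\<close> the edges
  \<open>(i + 1, j) \<rightarrow> (i, j)\<close>, and \<open>E'\<^bsub>k+1-i\<^esub>\<close> the edges \<open>(i - 1, j + 1) \<rightarrow> (i, j)\<close>
  (lemma \<open>F_block_entry\<close>).

  Row by row, the equation therefore says that the generating function of a vertex \<open>v\<close>, minus
  \<open>t\<close> times the sum of those of its predecessors, is \<open>1\<close> for \<open>v = (0, 0)\<close> and \<open>0\<close> otherwise.
  This is the decomposition of a nonempty path at its last edge, which works in every finite
  digraph (lemmas \<open>card_walks_Suc\<close> and \<open>walk_gf_rec\<close>). What remains is to translate between
  the linear index of a row and the pair of its block and the position inside it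
  (lemmas \<open>block_mat_mult_vec_index\<close> and \<open>block_start_F_eq\<close>).\<close>

definition walks :: "('a, 'b) pre_digraph \<Rightarrow> 'a \<Rightarrow> nat \<Rightarrow> 'a \<Rightarrow> 'a list set" where
  "walks G r n v = {p. vwalk p G \<and> vwalk_length p = n \<and> hd p = r \<and> last p = v}"

lemma finite_walks: "finite (verts G) \<Longrightarrow> finite (walks G r n v)"
  by (rule finite_subset[of _ "{p. set p \<subseteq> verts G \<and> length p = Suc n}"])
    (auto simp: walks_def vwalk_def Suc_diff_le Suc_leI finite_lists_length_eq)

lemma walks_0: "r \<in> verts G \<Longrightarrow> walks G r 0 v = (if v = r then {[r]} else {})"
  by (auto simp: walks_def vwalk_def le_Suc_eq length_Suc_conv)

lemma vwalk_snoc: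
  assumes "wf_digraph G" and "p \<noteq> []"
  shows "vwalk (p @ [v]) G \<longleftrightarrow> vwalk p G \<and> (last p, v) \<in> arcs_ends G"
  using assms wf_digraph.adj_in_verts(2)[OF assms(1), of "last p" v]
  by (auto simp: vwalk_def set_vwalk_arcs_snoc)

text \<open>Removing the last vertex of a walk of length \<open>n + 1\<close> to \<open>v\<close> leaves a walk of length \<open>n\<close>
  to a predecessor of \<open>v\<close>. The union is disjoint because its members are told apart by the last
  vertex but one; this turns it into the sum in \<open>card_walks_Suc\<close>.\<close>

lemma walks_Suc:
  assumes "wf_digraph G"
  shows "walks G r (Suc n) v =
    (\<Union>u \<in> {u \<in> verts G. (u, v) \<in> arcs_ends G}. (\<lambda>p. p @ [v]) ` walks G r n u)"
    (is "_ = ?U")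
proof (intro equalityI subsetI)
  fix p assume "p \<in> walks G r (Suc n) v"
  then have p: "vwalk p G" "length p - 1 = Suc n" "hd p = r" "last p = v"
    by (auto simp: walks_def)
  define q where "q = butlast p"
  have "p \<noteq> []" using p(2) by auto
  then have pq: "p = q @ [v]"
    using p(4) append_butlast_last_id[of p] by (simp add: q_def)
  then have q: "q \<noteq> []" using p(2) by auto
  then have "vwalk q G" "(last q, v) \<in> arcs_ends G"
    using p(1) assms by (simp_all add: pq vwalk_snoc)
  moreover have "q \<in> walks G r n (last q)"
    using p q \<open>vwalk q G\<close> by (simp add: walks_def pq)
  moreover have "last q \<in> verts G"
    using q \<open>vwalk q G\<close> last_in_set[of q] by (auto simp: vwalk_def)
  ultimately show "p \<in> ?U"
    unfolding pq by blast
next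
  fix p assume "p \<in> ?U"
  then obtain u q where "(u, v) \<in> arcs_ends G" "q \<in> walks G r n u" "p = q @ [v]"
    by auto
  moreover from this have "q \<noteq> []"
    by (auto simp: walks_def vwalk_def)
  ultimately show "p \<in> walks G r (Suc n) v"
    using assms by (auto simp: walks_def vwalk_snoc)
qed

lemma card_walks_Suc:
  assumes "wf_digraph G" and "finite (verts G)"
  shows "card (walks G r (Suc n) v) =
    (\<Sum>u | u \<in> verts G \<and> (u, v) \<in> arcs_ends G. card (walks G r n u))"
proof -
  have "inj_on (\<lambda>p. p @ [v]) S" for S :: "'a list set"
    by (simp add: inj_on_def)
  moreover have "disjoint_family_on (\<lambda>u. (\<lambda>p. p @ [v]) ` walks G r n u) A" for A
    by (auto simp: disjoint_family_on_def walks_def)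
  ultimately show ?thesis
    using assms
    by (simp add: walks_Suc card_UN_disjoint' finite_walks card_image)
qed

definition walk_gf :: "('a, 'b) pre_digraph \<Rightarrow> 'a \<Rightarrow> 'a \<Rightarrow> int fps" where
  "walk_gf G r v = Abs_fps (\<lambda>n. int (card (walks G r n v)))"

text \<open>The summand \<open>1\<close> is the one-vertex walk \<open>[r]\<close>, and the factor \<open>t\<close> accounts for the last edge
  of a longer walk.\<close>

lemma walk_gf_rec:
  assumes "wf_digraph G" and "finite (verts G)" and "r \<in> verts G"
  shows "walk_gf G r v = (if v = r then 1 else 0) +
    fps_X * (\<Sum>u | u \<in> verts G \<and> (u, v) \<in> arcs_ends G. walk_gf G r u)"
proof (rule fps_ext)
  fix n
  show "fps_nth (walk_gf G r v) n = fps_nth ((if v = r then 1 else 0) +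
    fps_X * (\<Sum>u | u \<in> verts G \<and> (u, v) \<in> arcs_ends G. walk_gf G r u)) n"
    using assms by (cases n) (auto simp: walk_gf_def walks_0 card_walks_Suc fps_sum_nth)
qed

lemma sum_block_start:
  fixes f :: "nat \<Rightarrow> 'a :: comm_monoid_add"
  shows "(\<Sum>c<block_start d m. f c) = (\<Sum>j<m. \<Sum>b<d j. f (block_start d j + b))"
proof (induction m)
  case (Suc m)
  have "(\<Sum>c<s + n. f c) = (\<Sum>c<s. f c) + (\<Sum>b<n. f (s + b))" for s n
    by (induction n) (simp_all add: add.assoc)
  then show ?case
    using Suc.IH by (simp add: block_start_def)
qed (simp add: block_start_def)

lemma less_block_startE:
  assumes "c < block_start d m"
  obtains i a where "i < m" and "a < d i" and "c = block_start d i + a"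
  using assms
proof (induction m arbitrary: thesis)
  case (Suc m)
  show ?case
  proof (cases "c < block_start d m")
    case True
    then show ?thesis using Suc by (metis less_SucI)
  next
    case False
    then have "c - block_start d m < d m" "c = block_start d m + (c - block_start d m)"
      using Suc.prems(2) by (auto simp: block_start_def)
    then show ?thesis using Suc.prems(1) by blast
  qed
qed (simp add: block_start_def)

lemma block_mat_mult_vec_index:
  assumes "x \<in> carrier_vec (block_start d m)" and "i < m" and "a < d i"
  shows "(block_mat m d B *\<^sub>v x) $ (block_start d i + a) =
    (\<Sum>j<m. \<Sum>b<d j. B i j $$ (a, b) * x $ (block_start d j + b))"
proof -
  let ?r = "block_start d i + a"
  have r: "?r < block_start d m"
    using assms by (simp add: block_start_add_less)
  have dim: "dim_row (block_mat m d B) = block_start d m" "dim_col (block_mat m d B) = block_start d m"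
    by (simp_all add: block_mat_def)
  have "(block_mat m d B *\<^sub>v x) $ ?r = (\<Sum>c<block_start d m. block_mat m d B $$ (?r, c) * x $ c)"
    using assms(1) r by (simp add: dim scalar_prod_def lessThan_atLeast0)
  also have "\<dots> = (\<Sum>j<m. \<Sum>b<d j. B i j $$ (a, b) * x $ (block_start d j + b))"
    unfolding sum_block_start using assms(2,3) by (intro sum.cong) (simp_all add: block_mat_index)
  finally show ?thesis .
qed

lemma wf_digraph_D: "wf_digraph (D k)"
  by unfold_locales (auto simp: D_def)

lemma arcs_ends_D: "(u, v) \<in> arcs_ends (D k) \<longleftrightarrow> u \<in> D_verts k \<and> v \<in> D_verts k \<and> step u v"
  by (force simp: arcs_ends_conv D_def)

lemma D_verts_Sigma: "D_verts k = (SIGMA j:{..<k + 1}. {..<k + 1 - j})"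
  by (auto simp: D_verts_def)

lemma path_gf_eq_walk_gf: "path_gf i j k = walk_gf (D k) (0, 0) (i, j)"
  by (simp add: path_gf_def walk_gf_def num_paths_def walks_def)

lemma path_gf_rec:
  assumes "v \<in> D_verts k"
  shows "case_prod path_gf v k = (if v = (0, 0) then 1 else 0) +
    fps_X * (\<Sum>u | u \<in> D_verts k \<and> step u v. case_prod path_gf u k)"
proof -
  have "finite (verts (D k))" "(0, 0) \<in> verts (D k)"
    by (simp_all add: D_def D_verts_Sigma)
  from walk_gf_rec[OF wf_digraph_D this, of v] show ?thesis
    using assms
    by (simp add: path_gf_eq_walk_gf arcs_ends_D case_prod_unfold) (simp add: D_def)
qed

text \<open>This is the identity \<open>F\<^sub>k = 1 - t M\<^sup>T\<close>, with \<open>M\<close> the adjacency matrix of \<open>D\<^sub>k\<close>. The transpose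
  appears because a row gathers the paths arriving at its vertex: the edge runs from the vertex
  \<open>(j, b)\<close> of the column to the vertex \<open>(i, a)\<close> of the row.\<close>

lemma F_block_entry:
  assumes "i + a \<le> k" and "j + b \<le> k"
  shows "F_block k i j $$ (a, b) =
    (if (j, b) = (i, a) then 1 else 0) - fps_X * (if step (j, b) (i, a) then 1 else 0)"
proof -
  have "a < k + 1 - i" "b < k + 1 - j"
    using assms by auto
  then show ?thesis
    by (auto simp: F_block_def A_mat_def E_mat_def E'_mat_def J_mat_def step_def)
qed

text \<open>The position that the arrangement of the vector assigns to the vertex \<open>(i, 0)\<close> is where
  block \<open>i\<close> starts.\<close>

lemma block_start_F_eq:
  assumes "i \<le> k"
  shows "block_start (\<lambda>i. k + 1 - i) i = i * (2 * k - i + 3) div 2"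
proof -
  from assms have "2 * block_start (\<lambda>i. k + 1 - i) i = i * (2 * k + 3 - i)"
  proof (induction i)
    case (Suc i)
    then obtain l where "k = i + l"
      using le_Suc_ex[of i k] by auto
    then show ?case
      using Suc by (simp add: block_start_def algebra_simps)
  qed (simp add: block_start_def)
  moreover from assms have "2 * k + 3 - i = 2 * k - i + 3"
    by simp
  ultimately have "2 * block_start (\<lambda>i. k + 1 - i) i = i * (2 * k - i + 3)"
    by (simp only:)
  then show ?thesis
    by (metis nonzero_mult_div_cancel_left zero_neq_numeral)
qed

theorem proposition1:
  fixes k :: nat and x :: "int fps vec"
  assumes "k \<ge> 1"
    and "x \<in> carrier_vec ((k + 2) choose 2)"
    and "\<And>i j. i + j \<le> k \<Longrightarrow> x $ (i * (2 * k - i + 3) div 2 + j) = path_gf i j k"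
  shows "F_mat k *\<^sub>v x = unit_vec ((k + 2) choose 2) 0"
proof (rule eq_vecI)
  show "dim_vec (F_mat k *\<^sub>v x) = dim_vec (unit_vec ((k + 2) choose 2) 0 :: int fps vec)"
    using F_mat_carrier[of k] by simp
next
  let ?d = "\<lambda>i. k + 1 - i"
  fix c
  assume "c < dim_vec (unit_vec ((k + 2) choose 2) 0 :: int fps vec)"
  then have c: "c < block_start ?d (k + 1)"
    using block_start_F[of k] by simp
  then obtain i a where ia: "i < k + 1" "a < k + 1 - i" and c_eq: "c = block_start ?d i + a"
    by (rule less_block_startE)
  have x: "x $ (block_start ?d j + b) = path_gf j b k" if "j + b \<le> k" for j b
    using assms(3)[OF that] that by (simp add: block_start_F_eq[simplified])
  have ia_D: "(i, a) \<in> D_verts k" and fin: "finite (D_verts k)"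
    using ia by (auto simp: D_verts_Sigma)
  have "(F_mat k *\<^sub>v x) $ c = (\<Sum>j<k + 1. \<Sum>b<?d j. F_block k i j $$ (a, b) * x $ (block_start ?d j + b))"
    unfolding F_mat_def c_eq
    by (rule block_mat_mult_vec_index) (use assms(2) ia block_start_F[of k] in auto)
  also have "\<dots> = (\<Sum>j<k + 1. \<Sum>b<?d j.
      ((if (j, b) = (i, a) then 1 else 0) - fps_X * (if step (j, b) (i, a) then 1 else 0)) *
      path_gf j b k)"
    using ia by (intro sum.cong refl arg_cong2[where f = "(*)"] F_block_entry x) auto
  also have "\<dots> = (\<Sum>u\<in>D_verts k.
      ((if u = (i, a) then 1 else 0) - fps_X * (if step u (i, a) then 1 else 0)) *
      case_prod path_gf u k)"
    unfolding D_verts_Sigma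
    by (subst sum.Sigma) (auto intro!: sum.cong simp del: sum.lessThan_Suc)
  also have "\<dots> = (\<Sum>u\<in>D_verts k. if u = (i, a) then case_prod path_gf u k else 0) -
      (\<Sum>u\<in>D_verts k. fps_X * (if step u (i, a) then case_prod path_gf u k else 0))"
    unfolding sum_subtractf[symmetric] by (intro sum.cong) (auto simp: algebra_simps)
  also have "\<dots> = path_gf i a k -
      fps_X * (\<Sum>u | u \<in> D_verts k \<and> step u (i, a). case_prod path_gf u k)"
    using fin ia_D by (simp add: sum_distrib_left[symmetric] sum.inter_filter)
  also have "\<dots> = (if (i, a) = (0, 0) then 1 else 0)"
    using path_gf_rec[OF ia_D] by simp
  also have "(i, a) = (0, 0) \<longleftrightarrow> c = 0"
    \<comment> \<open>block \<open>0\<close> has \<open>k + 1 > 0\<close> rows, so no later block starts at row \<open>0\<close>\<close>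
    using ia by (cases i) (auto simp: c_eq block_start_def)
  finally show "(F_mat k *\<^sub>v x) $ c = unit_vec ((k + 2) choose 2) 0 $ c"
    using c block_start_F[of k] by simp
qed

end
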